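(* Let $m\ge 1$, let $f_1,\dots,f_m\in\mathbb{D}[[x]]$, and let $n\in\mathbb{Z}_{\ge -1}^m$ be such that for some $i$ with $n_i\ge 0$ the quasideterminant $\rho^i(n)$ exists and is nonzero, so that the polynomials $\psi_k(n,x)=Z_k^{(i)}(n,x)[\rho^i(n)]^{-1}$, $k=1,\dots,m$, are defined (they do not depend on the choice of such $i$). Then $(\psi_1(n,x),\dots,\psi_m(n,x))$ is a Hermite--Padé form of degree $n$ for $(f_1,\dots,f_m)$, and $$f_1(x)\psi_1(n,x)+\dots+f_m(x)\psi_m(n,x)=x^{|n|+m-1}+\text{(terms of order higher than } |n|+m-1 \text{ in } x).$$
   Context: $\mathbb{D}$ is a (not necessarily commutative) division ring; $f_i(x)=\sum_{j\ge0}f^i_jx^j$, $i=1,\dots,m$, are formal power series with coefficients $f^i_j\in\mathbb{D}$, where $x$ commutes with all elements of $\mathbb{D}$; put $f^i_j=0$ for $j<0$. For $n=(n_1,\dots,n_m)\in\mathbb{Z}_{\ge-1}^m$ write $|n|=n_1+\dots+n_m$. Hermite--Padé form of degree $n$: a system of polynomials $(Y_1,\dots,Y_m)$ in $\mathbb{D}[x]$, not all zero, with $\deg Y_i\le n_i$ (the zero polynomial has degree $-1$), such that $f_1(x)Y_1(x)+\dots+f_m(x)Y_m(x)=x^{|n|+m-1}\Gamma(x)$ for some $\Gamma(x)\in\mathbb{D}[[x]]$. Quasideterminant: for a square matrix $X$, let $X^{pq}$ be $X$ with row $p$ and column $q$ deleted. If $X^{pq}$ is invertible, $|X|_{pq}=x_{pq}-r\,(X^{pq})^{-1}c$,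 where $r$ is row $p$ of $X$ without its $q$th entry and $c$ is column $q$ of $X$ without its $p$th entry (for a $1\times1$ matrix, $|X|_{11}=x_{11}$); the quasideterminant is said to exist when $X^{pq}$ is invertible. When $X$ is invertible and $(X^{-1})_{qp}\ne0$, it equals $((X^{-1})_{qp})^{-1}$. Matrix $\mathcal{M}(n)$: it has $|n|+m-1$ rows, indexed $r=0,\dots,|n|+m-2$, and $|n|+m$ columns divided into $m$ consecutive blocks; the $i$th block has $n_i+1$ columns indexed $c=0,\dots,n_i$ (empty if $n_i=-1$), and the entry in row $r$ and column $c$ of block $i$ is $f^i_{r-c}$. For $n_i\ge0$, $\rho^i(n)$ is the quasideterminant, with respect to the element in the last row and the last column of the $i$th block, of the square matrix obtained from $\mathcal{M}(n)$ by adding as last row the row $r=|n|+m-1$ given by the same rule (entries $f^l_{|n|+m-1-c}$, $c=0,\dots,n_l$, in block $l$). For $n_i\ge0$ and $k\in\{1,\dots,m\}$, $Z_k^{(i)}(n,x)$ is the quasideterminant, with respect to the element in the last row and the last column of the $i$th block, of the square matrix obtained from $\mathcal{M}(n)$ by adding as last row $X_k=(0,\dots,0,1,x,\dots,x^{n_k},0,\dots,0)$, which is zero except in block $k$, where it equals $(1,x,\dots,x^{n_k})$. (The submatrix to be inverted is the same as for $\rho^i(n)$ and has entries in $\mathbb{D}$.) *)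

theory Defs
  imports
    "Jordan_Normal_Form.Determinant"
    "HOL-Computational_Algebra.Polynomial_FPS"
begin

text \<open>
  Coefficients lie in a type of class \<open>division_ring\<close>, so nothing below assumes commutativity.
  The library makes \<^typ>\<open>'a poly\<close> a ring only over commutative coefficients; products of
  polynomials and power series are therefore formed in the (noncommutative) ring
  \<^typ>\<open>'a fps\<close>, in which \<^const>\<open>fps_X\<close> is central, via \<^const>\<open>fps_of_poly\<close>.
\<close>

section \<open>Quasideterminants\<close>

text \<open>Used only for invertible \<open>A\<close>, where the two-sided inverse is unique.\<close>

definition mat_inv :: "'a::ring_1 mat \<Rightarrow> 'a mat" where
  "mat_inv A = (THE B. inverts_mat A B \<and> inverts_mat B A)"

text \<open>Indices are 0-based. As in \<^const>\<open>mat_delete\<close>, \<^term>\<open>insert_index q\<close> enumerates all indices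
  other than \<open>q\<close> in increasing order.\<close>

definition quasidet_exists :: "'a::ring_1 mat \<Rightarrow> nat \<Rightarrow> nat \<Rightarrow> bool" where
  "quasidet_exists X p q \<longleftrightarrow> invertible_mat (mat_delete X p q)"

definition quasidet :: "'a::ring_1 mat \<Rightarrow> nat \<Rightarrow> nat \<Rightarrow> 'a" where
  "quasidet X p q =
     X $$ (p, q)
     - vec (dim_col X - 1) (\<lambda>j. X $$ (p, insert_index q j))
       \<bullet> (mat_inv (mat_delete X p q) *\<^sub>v vec (dim_row X - 1) (\<lambda>i. X $$ (insert_index p i, q)))"

section \<open>Hermite--Pade forms\<close>

definition total_degree :: "nat \<Rightarrow> (nat \<Rightarrow> int) \<Rightarrow> int" where
  "total_degree m n = (\<Sum>i=1..m. n i)"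

definition poly_deg :: "'a::zero poly \<Rightarrow> int" where
  "poly_deg p = (if p = 0 then - 1 else int (degree p))"

text \<open>The exponent \<open>|n| + m - 1\<close> is \<open>-1\<close> only if all \<open>n\<^sub>i = -1\<close>; then no form exists, because the
  degree bounds force every \<open>Y\<^sub>i\<close> to vanish, so the truncation by \<^const>\<open>nat\<close> is harmless.\<close>

definition hp_order :: "nat \<Rightarrow> (nat \<Rightarrow> int) \<Rightarrow> nat" where
  "hp_order m n = nat (total_degree m n + int m - 1)"

definition hermite_pade_form ::
    "nat \<Rightarrow> (nat \<Rightarrow> 'a::division_ring fps) \<Rightarrow> (nat \<Rightarrow> int) \<Rightarrow> (nat \<Rightarrow> 'a poly) \<Rightarrow> bool" where
  "hermite_pade_form m f n Y \<longleftrightarrow>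
     (\<exists>i\<in>{1..m}. Y i \<noteq> 0) \<and>
     (\<forall>i\<in>{1..m}. poly_deg (Y i) \<le> n i) \<and>
     (\<exists>\<Gamma>. (\<Sum>i=1..m. f i * fps_of_poly (Y i)) = fps_X ^ hp_order m n * \<Gamma>)"

section \<open>The matrix M(n) and its bordered versions\<close>

text \<open>The columns from left to right, each labelled by its block \<open>i\<close> and its index \<open>c\<close> in that block.\<close>

definition hp_columns :: "nat \<Rightarrow> (nat \<Rightarrow> int) \<Rightarrow> (nat \<times> nat) list" where
  "hp_columns m n = concat (map (\<lambda>i. map (\<lambda>c. (i, c)) [0..<nat (n i + 1)]) [1..<m + 1])"

text \<open>Position of the last column of block \<open>i\<close>, meaningful for \<open>n\<^sub>i \<ge> 0\<close>.\<close>

definition block_last :: "(nat \<Rightarrow> int) \<Rightarrow> nat \<Rightarrow> nat" where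
  "block_last n i = (\<Sum>l=1..i. nat (n l + 1)) - 1"

definition hp_row :: "nat \<Rightarrow> (nat \<Rightarrow> 'a::zero fps) \<Rightarrow> (nat \<Rightarrow> int) \<Rightarrow> nat \<Rightarrow> 'a vec" where
  "hp_row m f n r =
     vec (length (hp_columns m n))
       (\<lambda>j. case hp_columns m n ! j of (i, c) \<Rightarrow> if c \<le> r then fps_nth (f i) (r - c) else 0)"

definition hp_matrix :: "nat \<Rightarrow> (nat \<Rightarrow> 'a::zero fps) \<Rightarrow> (nat \<Rightarrow> int) \<Rightarrow> 'a mat" where
  "hp_matrix m f n =
     mat_of_rows (length (hp_columns m n)) (map (hp_row m f n) [0..<hp_order m n])"

definition rho_matrix :: "nat \<Rightarrow> (nat \<Rightarrow> 'a::zero fps) \<Rightarrow> (nat \<Rightarrow> int) \<Rightarrow> 'a mat" where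
  "rho_matrix m f n = hp_matrix m f n @\<^sub>r mat_of_row (hp_row m f n (hp_order m n))"

definition X_row :: "nat \<Rightarrow> (nat \<Rightarrow> int) \<Rightarrow> nat \<Rightarrow> 'a::ring_1 fps vec" where
  "X_row m n k =
     vec (length (hp_columns m n))
       (\<lambda>j. case hp_columns m n ! j of (i, c) \<Rightarrow> if i = k then fps_X ^ c else 0)"

definition Z_matrix :: "nat \<Rightarrow> (nat \<Rightarrow> 'a::ring_1 fps) \<Rightarrow> (nat \<Rightarrow> int) \<Rightarrow> nat \<Rightarrow> 'a fps mat" where
  "Z_matrix m f n k = map_mat fps_const (hp_matrix m f n) @\<^sub>r mat_of_row (X_row m n k)"

definition rho_exists ::
    "nat \<Rightarrow> (nat \<Rightarrow> 'a::division_ring fps) \<Rightarrow> (nat \<Rightarrow> int) \<Rightarrow> nat \<Rightarrow> bool" where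
  "rho_exists m f n i \<longleftrightarrow> quasidet_exists (rho_matrix m f n) (hp_order m n) (block_last n i)"

definition rho ::
    "nat \<Rightarrow> (nat \<Rightarrow> 'a::division_ring fps) \<Rightarrow> (nat \<Rightarrow> int) \<Rightarrow> nat \<Rightarrow> 'a" where
  "rho m f n i = quasidet (rho_matrix m f n) (hp_order m n) (block_last n i)"

text \<open>\<open>Z k i\<close> is a polynomial in \<open>x\<close> whenever it exists, but it is computed in \<^typ>\<open>'a fps\<close>; the
  matrix inverted there is the one for \<open>rho i\<close>, with its entries embedded as constants.\<close>

definition Z ::
    "nat \<Rightarrow> (nat \<Rightarrow> 'a::division_ring fps) \<Rightarrow> (nat \<Rightarrow> int) \<Rightarrow> nat \<Rightarrow> nat \<Rightarrow> 'a fps" where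
  "Z m f n k i = quasidet (Z_matrix m f n k) (hp_order m n) (block_last n i)"

definition rho_regular ::
    "nat \<Rightarrow> (nat \<Rightarrow> 'a::division_ring fps) \<Rightarrow> (nat \<Rightarrow> int) \<Rightarrow> nat \<Rightarrow> bool" where
  "rho_regular m f n i \<longleftrightarrow> i \<in> {1..m} \<and> n i \<ge> 0 \<and> rho_exists m f n i \<and> rho m f n i \<noteq> 0"

end

theory Submission
  imports Defs
begin

text \<open>
  If the quasideterminant \<open>|X|\<^sub>p\<^sub>q\<close> exists, there is a unique column \<open>u\<close> with \<open>u\<^sub>q = 1\<close> that is
  annihilated by all rows of \<open>X\<close> other than row \<open>p\<close>, and \<open>|X|\<^sub>p\<^sub>q\<close> is the product of row \<open>p\<close> with
  \<open>u\<close>. The same \<open>u\<close> serves for \<open>\<rho>\<^sup>i(n)\<close> and for all \<open>Z\<^sub>k\<^sup>(\<^sup>i\<^sup>)(n, x)\<close>. When \<open>\<rho>\<^sup>i(n)\<close> is nonzero, \<open>v = u \<rho>\<^sup>i(n)\<^sup>-\<^sup>1\<close>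
  is the unique column annihilated by \<open>\<M>(n)\<close> and sent to \<open>1\<close> by the additional row, hence does not
  depend on \<open>i\<close>. The entries of \<open>v\<close> are the coefficients of the \<open>\<psi>\<^sub>k\<close>, and row \<open>r\<close> times \<open>v\<close> is the
  coefficient of \<open>x\<^sup>r\<close> in \<open>\<Sum>\<^sub>k f\<^sub>k \<psi>\<^sub>k\<close>.
\<close>

section \<open>Quasideterminants as row times column\<close>

lemma mat_inv_eqI:
  fixes A B :: "'a::ring_1 mat"
  assumes A: "A \<in> carrier_mat N N" and B: "B \<in> carrier_mat N N"
    and AB: "A * B = 1\<^sub>m N" and BA: "B * A = 1\<^sub>m N"
  shows "mat_inv A = B"
  unfolding mat_inv_def
proof (rule the_equality)
  show "inverts_mat A B \<and> inverts_mat B A"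
    using assms by (auto simp: inverts_mat_def)
next
  fix C assume C: "inverts_mat A C \<and> inverts_mat C A"
  \<comment> \<open>\<open>inverts_mat\<close> fixes no dimensions, so the shape of \<open>C\<close>
    is read off from the two products, which are identity matrices.\<close>
  have "dim_col (A * C) = N" "dim_col (C * A) = dim_row C"
    using C A by (auto simp: inverts_mat_def)
  then have C': "C \<in> carrier_mat N N"
    using A by auto
  have "C = C * (A * B)"
    using C' AB by simp
  also have "\<dots> = C * A * B"
    using assoc_mult_mat[OF C' A B] by simp
  also have "\<dots> = B"
    using C C' B by (simp add: inverts_mat_def)
  finally show "C = B" .
qed

lemma mat_inv:
  fixes A :: "'a::ring_1 mat"
  assumes A: "A \<in> carrier_mat N N" and inv: "invertible_mat A"
  shows "mat_inv A \<in> carrier_mat N N" "A * mat_inv A = 1\<^sub>m N" "mat_inv A * A = 1\<^sub>m N"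
proof -
  obtain B where AB: "inverts_mat A B" and BA: "inverts_mat B A"
    using inv unfolding invertible_mat_def by blast
  have "dim_col (A * B) = N" "dim_col (B * A) = dim_row B"
    using AB BA A by (auto simp: inverts_mat_def)
  then have B: "B \<in> carrier_mat N N"
    using A by auto
  have "A * B = 1\<^sub>m N" "B * A = 1\<^sub>m N"
    using AB BA A B by (auto simp: inverts_mat_def)
  with mat_inv_eqI[OF A B] B
  show "mat_inv A \<in> carrier_mat N N" "A * mat_inv A = 1\<^sub>m N" "mat_inv A * A = 1\<^sub>m N"
    by auto
qed

text \<open>A homomorphism carries both inverse identities over to the image. Applied to
  \<open>fps_const\<close>, this reduces inversion over power series to inversion over the
  coefficients.\<close>

lemma mat_inv_hom:
  fixes h :: "'a::ring_1 \<Rightarrow> 'b::ring_1"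
  assumes h: "semiring_hom h" and A: "A \<in> carrier_mat N N" and inv: "invertible_mat A"
  shows "mat_inv (map_mat h A) = map_mat h (mat_inv A)"
proof -
  interpret semiring_hom h by (fact h)
  note I = mat_inv[OF A inv]
  show ?thesis
    using A I mat_hom_mult[OF A I(1)] mat_hom_mult[OF I(1) A]
    by (intro mat_inv_eqI[where N = N]) (auto simp: mat_hom_one)
qed

lemma mult_mat_vec_nth:
  assumes "A \<in> carrier_mat nr nc" "w \<in> carrier_vec nc" "i < nr"
  shows "(A *\<^sub>v w) $ i = (\<Sum>j<nc. A $$ (i, j) * w $ j)"
  using assms by (auto simp: scalar_prod_def atLeast0LessThan)

text \<open>Links sums along a full row with the row lacking entry \<open>q\<close> that occurs in
  \<open>quasidet\<close>.\<close>

lemma sum_insert_index: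
  fixes g :: "nat \<Rightarrow> 'a::comm_monoid_add"
  assumes "q < Suc N"
  shows "(\<Sum>j<Suc N. g j) = g q + (\<Sum>j<N. g (insert_index q j))"
proof -
  have "(\<Sum>j<N. g (insert_index q j)) = sum g (insert_index q ` {0..<N})"
    by (simp add: sum.reindex[OF insert_index_inj_on] lessThan_atLeast0)
  also have "insert_index q ` {0..<N} = {..<Suc N} - {q}"
    using insert_index_image[OF assms] by auto
  finally show ?thesis
    using assms by (simp add: sum.remove[of "{..<Suc N}" q g] del: sum.lessThan_Suc)
qed

text \<open>The column that the rows of \<open>X\<close> are multiplied with in the quasideterminant: it is \<open>1\<close> at \<open>q\<close>
  and \<open>- (X\<^sup>p\<^sup>q)\<^sup>-\<^sup>1 c\<close> elsewhere. It does not depend on row \<open>p\<close> of \<open>X\<close>.\<close>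

definition quasidet_coeff :: "'a::ring_1 mat \<Rightarrow> nat \<Rightarrow> nat \<Rightarrow> nat \<Rightarrow> 'a" where
  "quasidet_coeff X p q j =
     (if j = q then 1
      else - (mat_inv (mat_delete X p q) *\<^sub>v vec (dim_row X - 1) (\<lambda>i. X $$ (insert_index p i, q)))
               $ delete_index q j)"

lemma mat_delete_insert_index:
  assumes "X \<in> carrier_mat (Suc N) (Suc N)" "i < N" "j < N"
  shows "mat_delete X p q $$ (i, j) = X $$ (insert_index p i, insert_index q j)"
  using assms by (simp add: mat_delete_def insert_index_def)

lemma insert_index_less: "i < N \<Longrightarrow> insert_index p i < Suc N"
  by (simp add: insert_index_def)

context
  fixes X :: "'a::ring_1 mat" and N p q :: nat
  assumes X: "X \<in> carrier_mat (Suc N) (Suc N)" and p: "p < Suc N" and q: "q < Suc N"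
    and ex: "quasidet_exists X p q"
begin

private lemma carrier_minor: "mat_delete X p q \<in> carrier_mat N N"
  using X by (auto simp: mat_delete_def)

private lemmas minor_inv =
  mat_inv[OF carrier_minor ex[unfolded quasidet_exists_def]]

private abbreviation (input) "C \<equiv> vec N (\<lambda>i. X $$ (insert_index p i, q))"

private lemma coeff_insert_index:
  "quasidet_coeff X p q (insert_index q j) = - (mat_inv (mat_delete X p q) *\<^sub>v C) $ j"
  using X by (simp add: quasidet_coeff_def)

private lemma coeff_self: "quasidet_coeff X p q q = 1"
  by (simp add: quasidet_coeff_def)

lemma quasidet_eq_sum: "quasidet X p q = (\<Sum>j<Suc N. X $$ (p, j) * quasidet_coeff X p q j)"
  using X minor_inv(1)
  by (simp add: quasidet_def sum_insert_index[OF q] coeff_self coeff_insert_index scalar_prod_def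
      sum_negf atLeast0LessThan del: sum.lessThan_Suc index_mult_mat_vec)

text \<open>Let A be the minor and c the column \<open>q\<close> without entry \<open>p\<close>.
  Since A (A^-1 c) = c, the entries off \<open>q\<close> cancel the contribution of the 1 at
  \<open>q\<close>.\<close>

lemma quasidet_coeff_orthogonal:
  assumes "i < Suc N" "i \<noteq> p"
  shows "(\<Sum>j<Suc N. X $$ (i, j) * quasidet_coeff X p q j) = 0"
proof -
  define i' where "i' = delete_index p i"
  have i: "i = insert_index p i'" and i': "i' < N"
    using assms p by (auto simp: i'_def insert_delete_index delete_index_def)
  let ?B = "mat_inv (mat_delete X p q)"
  have "mat_delete X p q *\<^sub>v (?B *\<^sub>v C) = C"
    using assoc_mult_mat_vec[OF carrier_minor minor_inv(1), of C] minor_inv(2) by simp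
  then have "(mat_delete X p q *\<^sub>v (?B *\<^sub>v C)) $ i' = X $$ (i, q)"
    using i i' by simp
  moreover have "(mat_delete X p q *\<^sub>v (?B *\<^sub>v C)) $ i'
      = (\<Sum>j<N. X $$ (i, insert_index q j) * (?B *\<^sub>v C) $ j)"
    using carrier_minor minor_inv(1) i'
    by (subst mult_mat_vec_nth[where nr = N and nc = N])
      (auto simp: i mat_delete_insert_index[OF X] simp del: index_mult_mat_vec)
  ultimately show ?thesis
    by (simp add: sum_insert_index[OF q] coeff_self coeff_insert_index sum_negf
        del: sum.lessThan_Suc index_mult_mat_vec)
qed

text \<open>With w' the vector \<open>w\<close> without entry \<open>q\<close>, the equations read A
  w' = - c w_q; multiply by A^-1 on the left. The scalar \<open>w q\<close> stays on the right
  throughout, as noncommutativity demands.\<close>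

lemma quasidet_coeff_unique:
  assumes w: "\<And>i. i < Suc N \<Longrightarrow> i \<noteq> p \<Longrightarrow> (\<Sum>j<Suc N. X $$ (i, j) * w j) = 0"
    and j: "j < Suc N"
  shows "w j = quasidet_coeff X p q j * w q"
proof (cases "j = q")
  case True
  then show ?thesis by (simp add: coeff_self)
next
  case False
  define j' where "j' = delete_index q j"
  have jj: "j = insert_index q j'" and j': "j' < N"
    using False j q by (auto simp: j'_def insert_delete_index delete_index_def)
  let ?A = "mat_delete X p q"
  let ?B = "mat_inv (mat_delete X p q)"
  let ?w = "vec N (\<lambda>j. w (insert_index q j))"
  let ?c = "vec N (\<lambda>i. - (X $$ (insert_index p i, q) * w q))"
  have "?A *\<^sub>v ?w = ?c"
  proof (rule eq_vecI)
    fix i assume "i < dim_vec ?c"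
    then have i: "i < N" by simp
    have "(\<Sum>j<Suc N. X $$ (insert_index p i, j) * w j) = 0"
      using i by (intro w) (auto simp: insert_index_less)
    then have "X $$ (insert_index p i, q) * w q
        + (\<Sum>j<N. X $$ (insert_index p i, insert_index q j) * w (insert_index q j)) = 0"
      by (simp only: sum_insert_index[OF q])
    moreover have "(?A *\<^sub>v ?w) $ i
        = (\<Sum>j<N. X $$ (insert_index p i, insert_index q j) * w (insert_index q j))"
      using carrier_minor i
      by (subst mult_mat_vec_nth[where nr = N and nc = N])
        (auto simp: mat_delete_insert_index[OF X])
    ultimately show "(?A *\<^sub>v ?w) $ i = ?c $ i"
      using i by (simp add: eq_neg_iff_add_eq_0 add.commute)
  qed (use carrier_minor in auto)
  then have "?w = ?B *\<^sub>v ?c"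
    using assoc_mult_mat_vec[OF minor_inv(1) carrier_minor, of ?w] minor_inv(3) by simp
  then have "w j = (?B *\<^sub>v ?c) $ j'"
    using j' jj by (metis index_vec)
  also have "\<dots> = - (?B *\<^sub>v C) $ j' * w q"
    using j' minor_inv(1)
    by (simp add: scalar_prod_def sum_distrib_right sum_negf mult.assoc)
  finally show ?thesis
    by (simp add: jj coeff_insert_index del: index_mult_mat_vec)
qed

text \<open>Row \<open>p\<close> enters neither the minor nor the deleted column, so the column
  belonging to \<open>Y\<close> is the image of that of \<open>X\<close>, whatever row
  \<open>p\<close> of \<open>Y\<close> is. Meant for \<open>Z\<close>, whose last row holds powers
  of x.\<close>

lemma quasidet_hom_eq_sum:
  fixes h :: "'a \<Rightarrow> 'b::ring_1"
  assumes h: "semiring_hom h" and Y: "Y \<in> carrier_mat (Suc N) (Suc N)"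
    and YX: "\<And>i j. i < Suc N \<Longrightarrow> i \<noteq> p \<Longrightarrow> j < Suc N \<Longrightarrow> Y $$ (i, j) = h (X $$ (i, j))"
  shows "quasidet Y p q = (\<Sum>j<Suc N. Y $$ (p, j) * h (quasidet_coeff X p q j))"
proof -
  interpret semiring_hom h by (fact h)
  let ?B = "mat_inv (mat_delete X p q)"
  have "mat_delete Y p q = map_mat h (mat_delete X p q)"
    using X Y by (intro eq_matI)
      (auto simp: mat_delete_insert_index insert_index_less YX mat_delete_dim)
  then have B: "mat_inv (mat_delete Y p q) = map_mat h ?B"
    using mat_inv_hom[OF h carrier_minor] ex by (simp add: quasidet_exists_def)
  have c: "vec N (\<lambda>i. Y $$ (insert_index p i, q)) = map_vec h C"
    using Y q by (intro eq_vecI) (auto simp: YX insert_index_less)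
  have Bc: "map_mat h ?B *\<^sub>v map_vec h C = map_vec h (?B *\<^sub>v C)"
    using mult_mat_vec_hom[OF minor_inv(1), of C] by simp
  \<comment> \<open>\<open>semiring_hom\<close> covers only 0, 1, sums and products; negation
    follows from additivity.\<close>
  have neg: "h (- x) = - h x" for x
    using hom_add[of "- x" x] by (simp add: eq_neg_iff_add_eq_0)
  show ?thesis
    using Y minor_inv(1)
    by (simp add: quasidet_def B c Bc sum_insert_index[OF q] coeff_self coeff_insert_index neg
        scalar_prod_def sum_negf atLeast0LessThan del: sum.lessThan_Suc index_mult_mat_vec)
qed

end

lemma semiring_hom_fps_const: "semiring_hom (fps_const :: 'a::ring_1 \<Rightarrow> 'a fps)"
  by unfold_locales auto

section \<open>The columns of \<open>M(n)\<close>\<close>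

lemma length_hp_columns: "length (hp_columns m n) = (\<Sum>i=1..m. nat (n i + 1))"
  by (simp add: hp_columns_def length_concat comp_def interv_sum_list_conv_sum_set_nat
      atLeastLessThanSuc_atLeastAtMost del: upt_Suc sum.op_ivl_Suc)

lemma hp_columns_bounds:
  assumes "j < length (hp_columns m n)" "hp_columns m n ! j = (k, c)"
  shows "k \<in> {1..m}" "int c \<le> n k"
proof -
  have "(k, c) \<in> set (hp_columns m n)"
    using assms nth_mem by metis
  then show "k \<in> {1..m}" "int c \<le> n k"
    by (auto simp: hp_columns_def)
qed

text \<open>Makes the bordered matrices square. The block with \<open>n i \<ge> 0\<close> supplies a
  column, so |n| + m - 1 is nonnegative and \<open>nat\<close> in \<open>hp_order\<close> does not
  truncate.\<close>

lemma length_hp_columns_eq_Suc_hp_order: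
  assumes "\<forall>i\<in>{1..m}. n i \<ge> - 1" "i \<in> {1..m}" "n i \<ge> 0"
  shows "length (hp_columns m n) = Suc (hp_order m n)"
proof -
  have "int (nat (n i + 1)) = n i + 1" if "i \<in> {1..m}" for i
    using assms(1)[rule_format, OF that] by simp
  then have "int (\<Sum>i=1..m. nat (n i + 1)) = (\<Sum>i=1..m. n i + 1)"
    by (subst of_nat_sum) (rule sum.cong, auto)
  also have "\<dots> = total_degree m n + int m"
    by (simp add: total_degree_def sum.distrib)
  finally have eq: "int (length (hp_columns m n)) = total_degree m n + int m"
    by (simp add: length_hp_columns)
  have "nat (n i + 1) \<le> length (hp_columns m n)"
    unfolding length_hp_columns using assms(2) by (intro member_le_sum) auto
  with eq assms(3) show ?thesis
    unfolding hp_order_def by linarith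
qed

text \<open>Block \<open>i\<close> is nonempty, so the subtraction of 1 in \<open>block_last\<close>
  is a genuine one.\<close>

lemma block_last_less:
  assumes "i \<in> {1..m}" "n i \<ge> 0"
  shows "block_last n i < length (hp_columns m n)"
proof -
  have "nat (n i + 1) \<le> (\<Sum>l=1..i. nat (n l + 1))"
    using assms by (intro member_le_sum) auto
  moreover have "(\<Sum>l=1..i. nat (n l + 1)) \<le> (\<Sum>l=1..m. nat (n l + 1))"
    using assms by (intro sum_mono2) auto
  ultimately show ?thesis
    using assms unfolding block_last_def length_hp_columns by linarith
qed

lemma hp_matrix_carrier:
  "hp_matrix m f n \<in> carrier_mat (hp_order m n) (length (hp_columns m n))"
  by (rule carrier_matI) (simp_all add: hp_matrix_def)

lemma rho_matrix_index:
  assumes "length (hp_columns m n) = Suc N" "hp_order m n = N"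
  shows "rho_matrix m f n \<in> carrier_mat (Suc N) (Suc N)"
    and "r < Suc N \<Longrightarrow> j < Suc N \<Longrightarrow> rho_matrix m f n $$ (r, j) = hp_row m f n r $ j"
proof -
  have d: "dim_row (hp_matrix m f n) = N" "dim_col (hp_matrix m f n) = Suc N"
    using hp_matrix_carrier[of m f n] assms by auto
  have h: "dim_vec (hp_row m f n r) = Suc N" for r
    using assms by (simp add: hp_row_def)
  show "rho_matrix m f n \<in> carrier_mat (Suc N) (Suc N)"
    by (auto simp: rho_matrix_def append_rows_def d h mat_of_row_def)
  assume "r < Suc N" "j < Suc N"
  then show "rho_matrix m f n $$ (r, j) = hp_row m f n r $ j"
    using d h assms
    by (auto simp: rho_matrix_def append_rows_def d h hp_matrix_def mat_of_rows_index
        less_Suc_eq)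
qed

lemma Z_matrix_index:
  assumes "length (hp_columns m n) = Suc N" "hp_order m n = N"
  shows "Z_matrix m f n k \<in> carrier_mat (Suc N) (Suc N)"
    and "r < N \<Longrightarrow> j < Suc N \<Longrightarrow> Z_matrix m f n k $$ (r, j) = fps_const (hp_row m f n r $ j)"
    and "j < Suc N \<Longrightarrow> Z_matrix m f n k $$ (N, j) = X_row m n k $ j"
proof -
  have d: "dim_row (hp_matrix m f n) = N" "dim_col (hp_matrix m f n) = Suc N"
    using hp_matrix_carrier[of m f n] assms by auto
  have h: "dim_vec (X_row m n k :: 'a fps vec) = Suc N"
    using assms by (simp add: X_row_def)
  show "Z_matrix m f n k \<in> carrier_mat (Suc N) (Suc N)"
    by (auto simp: Z_matrix_def append_rows_def d h)
  show "j < Suc N \<Longrightarrow> Z_matrix m f n k $$ (N, j) = X_row m n k $ j"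
    using d h by (auto simp: Z_matrix_def append_rows_def)
  assume "r < N" "j < Suc N"
  then show "Z_matrix m f n k $$ (r, j) = fps_const (hp_row m f n r $ j)"
    using d assms
    by (auto simp: Z_matrix_def append_rows_def d h hp_matrix_def mat_of_rows_index)
qed

section \<open>Column vectors and systems of polynomials\<close>

text \<open>Cuts a column vector into blocks and reads block \<open>k\<close> as the coefficients of
  the \<open>k\<close>-th polynomial. The sum runs over all columns to match products with
  \<open>X_row\<close> and \<open>hp_row\<close>.\<close>

definition block_poly :: "nat \<Rightarrow> (nat \<Rightarrow> int) \<Rightarrow> (nat \<Rightarrow> 'a::comm_monoid_add) \<Rightarrow> nat \<Rightarrow> 'a poly" where
  "block_poly m n v k =
     (\<Sum>j<length (hp_columns m n). case hp_columns m n ! j of (i, c) \<Rightarrow>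
        if i = k then monom (v j) c else 0)"

lemma fps_of_poly_monom_noncomm:
  "fps_of_poly (monom c k) = fps_const c * (fps_X :: 'a::semiring_1 fps) ^ k"
  by (intro fps_ext) (simp add: fps_X_power_mult_right_nth)

text \<open>This is the shape that \<open>Z\<close> takes once its quasideterminant is expanded as
  row times column. The sides differ only by moving the central \<open>fps_X ^ c\<close> past a
  constant.\<close>

lemma fps_of_poly_block_poly:
  "fps_of_poly (block_poly m n v k) = (\<Sum>j<length (hp_columns m n). X_row m n k $ j * fps_const (v j))"
  unfolding block_poly_def fps_of_poly_sum
proof (intro sum.cong refl)
  fix j assume j: "j \<in> {..<length (hp_columns m n)}"
  obtain i c where ic: "hp_columns m n ! j = (i, c)" by force
  show "fps_of_poly (case hp_columns m n ! j of (i, c) \<Rightarrow> if i = k then monom (v j) c else 0)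
      = X_row m n k $ j * fps_const (v j)"
    using j fps_mult_fps_X_power_commute[of c "fps_const (v j)"]
    by (simp add: X_row_def ic fps_of_poly_monom_noncomm)
qed

lemma poly_deg_block_poly_le:
  assumes "n k \<ge> - 1"
  shows "poly_deg (block_poly m n v k) \<le> n k"
\<comment> \<open>The zero polynomial has \<open>poly_deg\<close> equal to -1; the bound on
  \<open>n k\<close> serves this case.\<close>
proof (cases "block_poly m n v k = 0")
  case False
  have coeff: "coeff (block_poly m n v k) d = 0" if "int d > n k" for d
    unfolding block_poly_def coeff_sum
  proof (intro sum.neutral ballI)
    fix j assume j: "j \<in> {..<length (hp_columns m n)}"
    obtain i c where ic: "hp_columns m n ! j = (i, c)" by force
    have "int c \<le> n i"
      using hp_columns_bounds(2)[of j m n i c] j ic by simp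
    with that show "coeff (case hp_columns m n ! j of (i, c) \<Rightarrow> if i = k then monom (v j) c else 0) d = 0"
      by (auto simp: ic)
  qed
  have "int (degree (block_poly m n v k)) \<le> n k"
    using coeff[of "degree (block_poly m n v k)"] False
    by (metis leading_coeff_0_iff not_le)
  with False show ?thesis by (simp add: poly_deg_def)
qed (use assms in \<open>simp add: poly_deg_def\<close>)

text \<open>Column (k, c) contributes x^c f_k v_j, whose coefficient at x^r is the matrix entry in
  row \<open>r\<close> times v_j; for c > r both vanish.\<close>

lemma nth_sum_block_poly:
  fixes f :: "nat \<Rightarrow> 'a::ring_1 fps"
  shows "fps_nth (\<Sum>k=1..m. f k * fps_of_poly (block_poly m n v k)) r
    = (\<Sum>j<length (hp_columns m n). hp_row m f n r $ j * v j)"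
proof -
  let ?L = "length (hp_columns m n)"
  have "(\<Sum>k=1..m. f k * fps_of_poly (block_poly m n v k))
      = (\<Sum>j<?L. \<Sum>k=1..m. f k * (X_row m n k $ j * fps_const (v j)))"
    unfolding fps_of_poly_block_poly sum_distrib_left by (rule sum.swap)
  also have "\<dots> = (\<Sum>j<?L. case hp_columns m n ! j of (k, c) \<Rightarrow> fps_X ^ c * f k * fps_const (v j))"
  proof (intro sum.cong refl)
    fix j assume j: "j \<in> {..<?L}"
    obtain k c where kc: "hp_columns m n ! j = (k, c)" by force
    have k: "k \<in> {1..m}"
      using hp_columns_bounds(1)[of j m n k c] j kc by auto
    have "(\<Sum>k'=1..m. f k' * (X_row m n k' $ j * fps_const (v j)))
        = (\<Sum>k'=1..m. if k' = k then f k * (fps_X ^ c * fps_const (v j)) else 0)"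
      using j kc by (intro sum.cong) (auto simp: X_row_def)
    also have "\<dots> = f k * (fps_X ^ c * fps_const (v j))"
      using k by simp
    \<comment> \<open>Only the central power of x moves; \<open>f k\<close> and \<open>v j\<close>
      keep their order.\<close>
    also have "\<dots> = fps_X ^ c * f k * fps_const (v j)"
      by (simp only: mult.assoc[symmetric] fps_mult_fps_X_power_commute[of c "f k"])
    finally show "(\<Sum>k'=1..m. f k' * (X_row m n k' $ j * fps_const (v j)))
        = (case hp_columns m n ! j of (k, c) \<Rightarrow> fps_X ^ c * f k * fps_const (v j))"
      by (simp add: kc)
  qed
  also have "fps_nth \<dots> r = (\<Sum>j<?L. hp_row m f n r $ j * v j)"
    unfolding fps_sum_nth
  proof (intro sum.cong refl)
    fix j assume j: "j \<in> {..<?L}"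
    obtain k c where kc: "hp_columns m n ! j = (k, c)" by force
    show "fps_nth (case hp_columns m n ! j of (k, c) \<Rightarrow> fps_X ^ c * f k * fps_const (v j)) r
        = hp_row m f n r $ j * v j"
      using j by (simp add: kc hp_row_def mult.assoc fps_X_power_mult_nth)
  qed
  finally show ?thesis .
qed

section \<open>The normalized solution of the bordered system and the resulting form\<close>

text \<open>The second claim is about every solution \<open>v\<close>, not just the one constructed
  for \<open>i\<close>. Hence a single \<open>v\<close> can be used for all regular indices.\<close>

lemma rho_regular_solution:
  fixes f :: "nat \<Rightarrow> 'a::division_ring fps"
  assumes n: "\<forall>i\<in>{1..m}. n i \<ge> - 1" and reg: "rho_regular m f n i"
  defines "N \<equiv> hp_order m n" and "R \<equiv> rho_matrix m f n"
  shows "\<exists>v. (\<forall>r<N. (\<Sum>j<Suc N. R $$ (r, j) * v j) = 0) \<and> (\<Sum>j<Suc N. R $$ (N, j) * v j) = 1"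
    and "\<forall>r<N. (\<Sum>j<Suc N. R $$ (r, j) * v j) = 0 \<Longrightarrow> (\<Sum>j<Suc N. R $$ (N, j) * v j) = 1 \<Longrightarrow>
      Z m f n k i * fps_const (inverse (rho m f n i)) = fps_of_poly (block_poly m n v k)"
proof -
  let ?q = "block_last n i"
  let ?u = "quasidet_coeff R N ?q"
  let ?\<rho> = "rho m f n i"
  have i: "i \<in> {1..m}" "n i \<ge> 0" and ex: "quasidet_exists R N ?q" and \<rho>: "?\<rho> \<noteq> 0"
    using reg by (auto simp: rho_regular_def rho_exists_def R_def N_def)
  have L: "length (hp_columns m n) = Suc N"
    using length_hp_columns_eq_Suc_hp_order[OF n i] by (simp add: N_def)
  have N_eq: "hp_order m n = N"
    by (simp add: N_def)
  have q: "?q < Suc N"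
    using block_last_less[of i m n] i L by simp
  have R: "R \<in> carrier_mat (Suc N) (Suc N)"
    unfolding R_def by (rule rho_matrix_index(1)[OF L N_eq])
  note qd = R lessI q ex
  have \<rho>_sum: "?\<rho> = (\<Sum>j<Suc N. R $$ (N, j) * ?u j)"
    using quasidet_eq_sum[OF qd] by (simp add: rho_def R_def N_def)
  \<comment> \<open>The normalizing factor sits on the right of the column, so it can be pulled out
    of the product with a row.\<close>
  have scale: "(\<Sum>j<Suc N. R $$ (r, j) * (?u j * inverse ?\<rho>))
      = (\<Sum>j<Suc N. R $$ (r, j) * ?u j) * inverse ?\<rho>" for r
    by (simp only: sum_distrib_right mult.assoc)
  have "(\<Sum>j<Suc N. R $$ (r, j) * (?u j * inverse ?\<rho>)) = 0" if "r < N" for r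
    unfolding scale using quasidet_coeff_orthogonal[OF qd, of r] that by simp
  moreover have "(\<Sum>j<Suc N. R $$ (N, j) * (?u j * inverse ?\<rho>)) = 1"
    unfolding scale \<rho>_sum[symmetric] using \<rho> by (rule right_inverse)
  ultimately show "\<exists>v. (\<forall>r<N. (\<Sum>j<Suc N. R $$ (r, j) * v j) = 0) \<and> (\<Sum>j<Suc N. R $$ (N, j) * v j) = 1"
    by (intro exI[of _ "\<lambda>j. ?u j * inverse ?\<rho>"]) blast
  assume v0: "\<forall>r<N. (\<Sum>j<Suc N. R $$ (r, j) * v j) = 0"
    and v1: "(\<Sum>j<Suc N. R $$ (N, j) * v j) = 1"
  have "v j = ?u j * v ?q" if "j < Suc N" for j
  proof (rule quasidet_coeff_unique[OF qd _ that])
    show "(\<Sum>j<Suc N. R $$ (r, j) * v j) = 0" if "r < Suc N" "r \<noteq> N" for r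
      using v0 that less_SucE by blast
  qed
  \<comment> \<open>The common right factor is \<open>v ?q\<close>; the last row then forces
    \<open>?\<rho> * c = 1\<close>.\<close>
  then obtain c where v: "\<And>j. j < Suc N \<Longrightarrow> v j = ?u j * c"
    by blast
  have "1 = (\<Sum>j<Suc N. R $$ (N, j) * (?u j * c))"
    unfolding v1[symmetric] by (rule sum.cong) (simp_all only: v lessThan_iff)
  also have "\<dots> = ?\<rho> * c"
    by (simp only: \<rho>_sum sum_distrib_right mult.assoc)
  finally have c: "c = inverse ?\<rho>"
    using inverse_unique[of ?\<rho> "c"] by simp
  \<comment> \<open>Above the last row, \<open>Z_matrix\<close> consists of the entries of
    \<open>R\<close> as constants, so the column \<open>?u\<close> over the division ring serves
    here too.\<close>
  have "Z m f n k i = (\<Sum>j<Suc N. Z_matrix m f n k $$ (N, j) * fps_const (?u j))"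
    unfolding Z_def N_def[symmetric]
  proof (rule quasidet_hom_eq_sum[OF qd semiring_hom_fps_const Z_matrix_index(1)[OF L N_eq]])
    fix r j assume "r < Suc N" "r \<noteq> N" "j < Suc N"
    then show "Z_matrix m f n k $$ (r, j) = fps_const (R $$ (r, j))"
      using Z_matrix_index(2)[OF L N_eq, of r j f k] rho_matrix_index(2)[OF L N_eq, of r j f]
      by (simp add: R_def)
  qed
  also have "\<dots> = (\<Sum>j<Suc N. X_row m n k $ j * fps_const (?u j))"
    by (rule sum.cong) (simp_all only: Z_matrix_index(3)[OF L N_eq] lessThan_iff)
  finally have "Z m f n k i * fps_const (inverse ?\<rho>)
      = (\<Sum>j<Suc N. X_row m n k $ j * fps_const (?u j * inverse ?\<rho>))"
    by (simp only: sum_distrib_right mult.assoc fps_const_mult)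
  also have "\<dots> = (\<Sum>j<Suc N. X_row m n k $ j * fps_const (v j))"
    unfolding c[symmetric] by (rule sum.cong) (simp_all only: v lessThan_iff)
  finally show "Z m f n k i * fps_const (inverse ?\<rho>) = fps_of_poly (block_poly m n v k)"
    by (simp only: fps_of_poly_block_poly L)
qed

theorem proposition3p4:
  fixes m :: nat
    and f :: "nat \<Rightarrow> 'a::division_ring fps"
    and n :: "nat \<Rightarrow> int"
  assumes "m \<ge> 1"
    and "\<forall>i\<in>{1..m}. n i \<ge> - 1"
    and "\<exists>i. rho_regular m f n i"
  shows "\<exists>\<psi> :: nat \<Rightarrow> 'a poly.
    (\<forall>i. rho_regular m f n i \<longrightarrow>
       (\<forall>k\<in>{1..m}. fps_of_poly (\<psi> k) = Z m f n k i * fps_const (inverse (rho m f n i)))) \<and>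
    hermite_pade_form m f n \<psi> \<and>
    (\<exists>\<Gamma>. (\<Sum>k=1..m. f k * fps_of_poly (\<psi> k))
          = fps_X ^ hp_order m n + fps_X ^ (hp_order m n + 1) * \<Gamma>)"
proof -
  define N where "N = hp_order m n"
  let ?R = "rho_matrix m f n"
  obtain i where i: "rho_regular m f n i"
    using assms(3) by blast
  then have L: "length (hp_columns m n) = Suc N"
    using length_hp_columns_eq_Suc_hp_order[OF assms(2)] by (auto simp: rho_regular_def N_def)
  \<comment> \<open>One regular index yields \<open>v\<close>; the polynomials built from it are
    compared with every other regular index at the end.\<close>
  obtain v where v0: "\<forall>r<N. (\<Sum>j<Suc N. ?R $$ (r, j) * v j) = 0"
    and v1: "(\<Sum>j<Suc N. ?R $$ (N, j) * v j) = 1"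
    using rho_regular_solution(1)[OF assms(2) i] unfolding N_def by blast
  define \<psi> where "\<psi> = block_poly m n v"
  define S where "S = (\<Sum>k=1..m. f k * fps_of_poly (\<psi> k))"
  \<comment> \<open>\<open>?R\<close> has rows only up to \<open>N\<close>; higher coefficients of
    \<open>S\<close> are unconstrained and go into the remainder.\<close>
  have S_nth: "fps_nth S r = (\<Sum>j<Suc N. ?R $$ (r, j) * v j)" if "r < Suc N" for r
    unfolding S_def \<psi>_def nth_sum_block_poly L
    using that rho_matrix_index(2)[OF L N_def[symmetric], where f = f] by (intro sum.cong) auto
  have low: "fps_nth S r = 0" if "r < N" for r
    using S_nth[of r] v0 that by simp
  have top: "fps_nth S N = 1"
    using S_nth[of N] v1 by simp
  have S: "S = fps_X ^ N + fps_X ^ (N + 1) * fps_shift (N + 1) S"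
    using low top
    by (intro fps_ext)
      (auto simp: fps_X_power_mult_nth fps_X_power_nth less_Suc_eq simp del: power_Suc)
  \<comment> \<open>If all polynomials vanished, so would the coefficient 1 of x^N in
    \<open>S\<close>.\<close>
  have "\<exists>k\<in>{1..m}. \<psi> k \<noteq> 0"
  proof (rule ccontr)
    assume "\<not> ?thesis"
    then have "S = 0" by (simp add: S_def)
    with top show False by simp
  qed
  \<comment> \<open>Factoring out x^N gives the witness for the order condition of the form.\<close>
  moreover have "S = fps_X ^ N * (1 + fps_X * fps_shift (N + 1) S)"
    using S by (simp add: distrib_left mult.assoc power_commutes flip: mult.assoc)
  ultimately have "hermite_pade_form m f n \<psi>"
    using assms(2) poly_deg_block_poly_le[of n _ m v]
    unfolding hermite_pade_form_def S_def[symmetric] N_def[symmetric] by (auto simp: \<psi>_def)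
  moreover have "fps_of_poly (\<psi> k) = Z m f n k i * fps_const (inverse (rho m f n i))"
    if "rho_regular m f n i" for i k
    unfolding \<psi>_def
    by (rule rho_regular_solution(2)[OF assms(2) that v0[unfolded N_def] v1[unfolded N_def], symmetric])
  moreover have "\<exists>\<Gamma>. (\<Sum>k=1..m. f k * fps_of_poly (\<psi> k))
      = fps_X ^ hp_order m n + fps_X ^ (hp_order m n + 1) * \<Gamma>"
    unfolding S_def[symmetric] N_def[symmetric] using S by blast
  ultimately show ?thesis
    by blast
qed

end
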